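(* Let $G$ be a finite simple graph on the vertex set $[n]=\{1,\ldots,n\}$, let $K$ be a field with $\operatorname{char} K \neq 2$, and let $\mathcal{I}_G \subseteq S = K[x_1,\ldots,x_n,y_1,\ldots,y_n]$ be the parity binomial edge ideal of $G$. If $\mathcal{I}_G^{(t)} = \mathcal{I}_G^t$ for every integer $t \geq 1$, then $G$ is net-free.
   Context: For a finite simple graph $G$ with vertex set $V(G)=[n]$ and edge set $E(G)$, and a field $K$, let $S = K[x_1,\ldots,x_n,y_1,\ldots,y_n]$ be the polynomial ring in $2n$ variables. The parity binomial edge ideal of $G$ is $\mathcal{I}_G = (x_i x_j - y_i y_j : \{i,j\}\in E(G)) \subseteq S$. Symbolic powers: if $\mathfrak{p}_1,\ldots,\mathfrak{p}_r$ are the minimal primes of an ideal $I$ in a Noetherian ring, then the $m$-th symbolic power of $I$ is $I^{(m)} = \mathfrak{q}_1\cap\cdots\cap\mathfrak{q}_r$, where $\mathfrak{q}_i$ is the $\mathfrak{p}_i$-primary component of the ordinary power $I^m$. A net is a graph isomorphic to the graph on the vertices $1,\ldots,6$ with edge set $\{\{1,2\},\{2,3\},\{3,4\},\{3,5\},\{2,5\},\{5,6\}\}$ (a triangle with one pendant edge attached at each of its three vertices). A graph is net-free if it has no induced subgraph that is a net. *)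

theory Defs
  imports
    "HOL-Library.Poly_Mapping"
    "HOL-Algebra.Ideal_Product"
    "HOL-Computational_Algebra.Computational_Algebra"
begin

subsection \<open>Finite simple graphs\<close>

definition simple_graph :: "'a set \<Rightarrow> 'a set set \<Rightarrow> bool" where
  "simple_graph V E \<longleftrightarrow> finite V \<and> (\<forall>e\<in>E. e \<subseteq> V \<and> card e = 2)"

definition graph_isomorphic :: "'a set \<Rightarrow> 'a set set \<Rightarrow> 'b set \<Rightarrow> 'b set set \<Rightarrow> bool" where
  "graph_isomorphic V E V' E' \<longleftrightarrow> (\<exists>f. bij_betw f V V' \<and> E' = (`) f ` E)"

definition induced_edges :: "'a set set \<Rightarrow> 'a set \<Rightarrow> 'a set set" where
  "induced_edges E W = {e \<in> E. e \<subseteq> W}"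

definition net_vertices :: "nat set" where
  "net_vertices = {1..6}"

definition net_edges :: "nat set set" where
  "net_edges = {{1,2}, {2,3}, {3,4}, {3,5}, {2,5}, {5,6}}"

definition is_net :: "'a set \<Rightarrow> 'a set set \<Rightarrow> bool" where
  "is_net V E \<longleftrightarrow> graph_isomorphic net_vertices net_edges V E"

definition net_free :: "'a set \<Rightarrow> 'a set set \<Rightarrow> bool" where
  "net_free V E \<longleftrightarrow> \<not> (\<exists>W\<subseteq>V. is_net W (induced_edges E W))"


subsection \<open>Polynomial rings\<close>

text \<open>Exponent vectors are finitely supported functions from the variables to \<^typ>\<open>nat\<close>; a
  polynomial is a finitely supported family of coefficients, multiplied by convolution.\<close>

type_synonym ('v, 'k) mpoly = "('v \<Rightarrow>\<^sub>0 nat) \<Rightarrow>\<^sub>0 'k"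

definition mpoly_ring :: "'v set \<Rightarrow> ('v, 'k::comm_ring_1) mpoly ring" where
  "mpoly_ring V = \<lparr> carrier = {p. \<forall>m\<in>Poly_Mapping.keys p. Poly_Mapping.keys m \<subseteq> V},
     monoid.mult = (*), one = 1, ring.zero = 0, add = (+) \<rparr>"

definition mvar :: "'v \<Rightarrow> ('v, 'k::comm_ring_1) mpoly" where
  "mvar v = Poly_Mapping.single (Poly_Mapping.single v 1) 1"

lemma cring_mpoly_ring: "cring (mpoly_ring V :: ('v, 'k::comm_ring_1) mpoly ring)"
proof (rule cringI)
  show "abelian_group (mpoly_ring V :: ('v, 'k) mpoly ring)"
  proof (rule abelian_groupI, goal_cases)
    case (1 p q)
    then show ?case
      using Poly_Mapping.keys_add[of p q] by (auto simp: mpoly_ring_def)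
  next
    case (6 p)
    then show ?case
      by (intro bexI[of _ "- p"]) (auto simp: mpoly_ring_def)
  qed (auto simp: mpoly_ring_def algebra_simps)
next
  show "comm_monoid (mpoly_ring V :: ('v, 'k) mpoly ring)"
  proof (rule comm_monoidI, goal_cases)
    case (1 p q)
    show ?case
      unfolding mpoly_ring_def
    proof (clarsimp, goal_cases)
      case (1 m v)
      obtain a b where ab: "a \<in> Poly_Mapping.keys p" "b \<in> Poly_Mapping.keys q" "m = a + b"
        using keys_mult[of p q] 1(1) by blast
      with 1(2) \<open>p \<in> _\<close> \<open>q \<in> _\<close> show ?case
        using Poly_Mapping.keys_add[of a b] by (simp add: mpoly_ring_def) blast
    qed
  qed (auto simp: mpoly_ring_def algebra_simps)
qed (auto simp: mpoly_ring_def algebra_simps)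


subsection \<open>Symbolic powers\<close>

abbreviation ideal_power :: "('a, 'b) ring_scheme \<Rightarrow> 'a set \<Rightarrow> nat \<Rightarrow> 'a set" where
  "ideal_power R I m \<equiv> I [^]\<^bsub>ideals_set R\<^esub> m"

definition ideal_radical :: "('a, 'b) ring_scheme \<Rightarrow> 'a set \<Rightarrow> 'a set" where
  "ideal_radical R I = {a \<in> carrier R. \<exists>k::nat. k \<ge> 1 \<and> a [^]\<^bsub>R\<^esub> k \<in> I}"

definition primary_ideal :: "('a, 'b) ring_scheme \<Rightarrow> 'a set \<Rightarrow> bool" where
  "primary_ideal R Q \<longleftrightarrow> ideal Q R \<and> Q \<noteq> carrier R \<and>
     (\<forall>a\<in>carrier R. \<forall>b\<in>carrier R. a \<otimes>\<^bsub>R\<^esub> b \<in> Q \<longrightarrow> a \<in> Q \<or> b \<in> ideal_radical R Q)"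

definition minimal_primes :: "('a, 'b) ring_scheme \<Rightarrow> 'a set \<Rightarrow> 'a set set" where
  "minimal_primes R I = {P. primeideal P R \<and> I \<subseteq> P \<and>
     (\<forall>P'. primeideal P' R \<and> I \<subseteq> P' \<and> P' \<subseteq> P \<longrightarrow> P' = P)}"

text \<open>The intersections are taken inside the ring, so that the empty one is the whole ring.\<close>

definition minimal_primary_decomposition ::
    "('a, 'b) ring_scheme \<Rightarrow> 'a set \<Rightarrow> 'a set set \<Rightarrow> bool" where
  "minimal_primary_decomposition R J \<Q> \<longleftrightarrow>
     finite \<Q> \<and> (\<forall>Q\<in>\<Q>. primary_ideal R Q) \<and> carrier R \<inter> \<Inter>\<Q> = J \<and>
     inj_on (ideal_radical R) \<Q> \<and> (\<forall>Q\<in>\<Q>. carrier R \<inter> \<Inter>(\<Q> - {Q}) \<noteq> J)"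

definition is_primary_component :: "('a, 'b) ring_scheme \<Rightarrow> 'a set \<Rightarrow> 'a set \<Rightarrow> 'a set \<Rightarrow> bool" where
  "is_primary_component R J P Q \<longleftrightarrow>
     (\<exists>\<Q>. minimal_primary_decomposition R J \<Q> \<and> Q \<in> \<Q> \<and> ideal_radical R Q = P)"

text \<open>In a Noetherian ring, for each minimal prime \<open>P\<close> of \<open>I\<close> there is exactly one \<open>Q\<close> which is
  the \<open>P\<close>-primary component of the \<open>m\<close>-th power of \<open>I\<close> (for positive \<open>m\<close>), whichever primary
  decomposition is used.\<close>

definition symbolic_power :: "('a, 'b) ring_scheme \<Rightarrow> 'a set \<Rightarrow> nat \<Rightarrow> 'a set" where
  "symbolic_power R I m =
     carrier R \<inter> \<Inter>{Q. \<exists>P\<in>minimal_primes R I. is_primary_component R (ideal_power R I m) P Q}"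


subsection \<open>Parity binomial edge ideals\<close>

datatype xyvar = X nat | Y nat

definition xy_ring :: "nat \<Rightarrow> (xyvar, 'k::field) mpoly ring" where
  "xy_ring n = mpoly_ring (X ` {1..n} \<union> Y ` {1..n})"

definition parity_binomial_edge_ideal :: "nat \<Rightarrow> nat set set \<Rightarrow> (xyvar, 'k::field) mpoly set" where
  "parity_binomial_edge_ideal n E =
     Idl\<^bsub>xy_ring n\<^esub> {mvar (X i) * mvar (X j) - mvar (Y i) * mvar (Y j) | i j. {i, j} \<in> E}"

end

theory Submission
  imports Defs
begin

text \<open>
  Already the second symbolic power detects a net. Write \<open>p\<^sub>i\<^sub>j = x\<^sub>i x\<^sub>j - y\<^sub>i y\<^sub>j\<close> for the
  generators of the ideal \<open>I\<close> and \<open>D\<^sub>i\<^sub>j = x\<^sub>i y\<^sub>j - y\<^sub>i x\<^sub>j\<close> for the minors of the generic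
  \<open>2 \<times> n\<close> matrix. For a triangle \<open>a, b, c\<close> with pendant edges \<open>{a, a'}, {b, b'}, {c, c'}\<close> the witness
  is \<open>f = D\<^bsub>ab'\<^esub> D\<^bsub>bc'\<^esub> D\<^bsub>ca'\<^esub>\<close>.

  It lies in the symbolic square because at every minimal prime \<open>P\<close> of \<open>I\<close> at least two of its three
  factors lie in the localisation of \<open>I\<close>. The factors of \<open>f\<close> fit together cyclically: the vertex \<open>a\<close>
  is adjacent to both indices of \<open>D\<^bsub>ca'\<^esub>\<close> and is itself an index of \<open>D\<^bsub>ab'\<^esub>\<close>, and similarly for \<open>b\<close>
  and \<open>c\<close>. If \<open>x\<^sub>a\<close> or \<open>y\<^sub>a\<close> is invertible at \<open>P\<close>, then \<open>D\<^bsub>ca'\<^esub>\<close> is in the localised ideal, as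
  \<open>x\<^sub>k D\<^sub>i\<^sub>j\<close> and \<open>y\<^sub>k D\<^sub>i\<^sub>j\<close> are combinations of \<open>p\<^sub>k\<^sub>i\<close> and \<open>p\<^sub>k\<^sub>j\<close>
  (\<open>minor_of_neighbours\<close>). If both \<open>x\<^sub>a\<close> and \<open>y\<^sub>a\<close> belong to \<open>P\<close>, then by minimality of \<open>P\<close> they are even
  in the localised ideal, hence so is \<open>D\<^bsub>ab'\<^esub>\<close> (\<open>minor_at_vanishing_vertex_in_saturation\<close>). So each of
  \<open>a, b, c\<close> contributes one of its two factors, and every factor belongs to only two of these three
  vertices.

  The use of minimality is geometric. The columns of the neighbours of \<open>a\<close> cannot all be proportional
  at the generic point of \<open>P\<close>: otherwise the column of \<open>a\<close>, which is zero there, could be moved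
  along a line without leaving the zero set of \<open>I\<close>, and the zero set of \<open>P\<close> would lie in a larger
  irreducible set (\<open>minimal_prime_no_translation\<close>). So some minor \<open>D\<^sub>i\<^sub>j\<close> of two neighbours of
  \<open>a\<close> is invertible at \<open>P\<close>, and \<open>x\<^sub>a D\<^sub>i\<^sub>j\<close> and \<open>y\<^sub>a D\<^sub>i\<^sub>j\<close> lie in \<open>I\<close>.

  That \<open>f\<close> is not in \<open>I\<^sup>2\<close> is visible along the line with \<open>(x, y) = (0, t)\<close> at the triangle vertices,
  \<open>(1, 0)\<close> at \<open>a', b', c'\<close> and \<open>(0, 0)\<close> at all other vertices: as \<open>a', b', c'\<close> are pairwise
  non-adjacent, every generator becomes \<open>0\<close> or \<open>- t\<^sup>2\<close>, so that \<open>I\<^sup>2\<close> lands in the multiples of \<open>t\<^sup>4\<close>, but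
  \<open>f\<close> becomes \<open>- t\<^sup>3\<close>.
\<close>

section \<open>Substituting polynomials in one parameter\<close>

definition monomial_value :: "('v \<Rightarrow> 'r::comm_ring_1) \<Rightarrow> ('v \<Rightarrow>\<^sub>0 nat) \<Rightarrow> 'r" where
  "monomial_value \<sigma> m = (\<Prod>v\<in>Poly_Mapping.keys m. \<sigma> v ^ Poly_Mapping.lookup m v)"

text \<open>The substitution that replaces each variable \<open>v\<close> by a polynomial \<open>\<sigma> v\<close> in a new parameter \<open>t\<close>
  whose coefficients are again multivariate. It thus covers two kinds of lines:
  translations \<open>v \<mapsto> v + t c\<close> of the generic point, and lines of numerical points.\<close>

definition line_subst ::
    "('v \<Rightarrow> ('v, 'k::comm_ring_1) mpoly poly) \<Rightarrow> ('v, 'k) mpoly \<Rightarrow> ('v, 'k) mpoly poly" where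
  "line_subst \<sigma> p =
     (\<Sum>m\<in>Poly_Mapping.keys p.
        [:Poly_Mapping.single 0 (Poly_Mapping.lookup p m):] * monomial_value \<sigma> m)"

lemma poly_mapping_eq_sum_single:
  fixes p :: "'a \<Rightarrow>\<^sub>0 'b::comm_monoid_add"
  shows "p = (\<Sum>m\<in>Poly_Mapping.keys p. Poly_Mapping.single m (Poly_Mapping.lookup p m))"
proof (rule poly_mapping_eqI)
  fix k
  show "Poly_Mapping.lookup p k =
    Poly_Mapping.lookup (\<Sum>m\<in>Poly_Mapping.keys p. Poly_Mapping.single m (Poly_Mapping.lookup p m)) k"
    by (cases "k \<in> Poly_Mapping.keys p")
      (auto simp: lookup_sum lookup_single when_def in_keys_iff intro!: sum.neutral[symmetric])
qed

lemma monomial_value_superset: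
  assumes "finite A" "Poly_Mapping.keys m \<subseteq> A"
  shows "monomial_value \<sigma> m = (\<Prod>v\<in>A. \<sigma> v ^ Poly_Mapping.lookup m v)"
  unfolding monomial_value_def
  by (rule prod.mono_neutral_left[OF assms]) (auto simp: in_keys_iff)

lemma monomial_value_0 [simp]: "monomial_value \<sigma> 0 = 1"
  by (simp add: monomial_value_def)

lemma monomial_value_add: "monomial_value \<sigma> (m + n) = monomial_value \<sigma> m * monomial_value \<sigma> n"
proof -
  let ?A = "Poly_Mapping.keys m \<union> Poly_Mapping.keys n"
  have "monomial_value \<sigma> (m + n) = (\<Prod>v\<in>?A. \<sigma> v ^ Poly_Mapping.lookup (m + n) v)"
    by (intro monomial_value_superset finite_UnI finite_keys Poly_Mapping.keys_add)
  also have "\<dots> = (\<Prod>v\<in>?A. \<sigma> v ^ Poly_Mapping.lookup m v) * (\<Prod>v\<in>?A. \<sigma> v ^ Poly_Mapping.lookup n v)"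
    by (simp add: lookup_add power_add prod.distrib)
  also have "\<dots> = monomial_value \<sigma> m * monomial_value \<sigma> n"
    by (subst (1 2) monomial_value_superset[of ?A]) auto
  finally show ?thesis .
qed

lemma monomial_value_mvar:
  "monomial_value mvar m = (Poly_Mapping.single m 1 :: ('v, 'k::comm_ring_1) mpoly)"
proof -
  have power: "(mvar v :: ('v, 'k) mpoly) ^ e = Poly_Mapping.single (Poly_Mapping.single v e) 1" for v e
    by (induction e) (simp_all add: mvar_def mult_single single_add[symmetric])
  have "monomial_value mvar m =
      (\<Prod>v\<in>A. Poly_Mapping.single (Poly_Mapping.single v (Poly_Mapping.lookup m v)) (1::'k))"
    if "A = Poly_Mapping.keys m" for A
    using that by (simp add: monomial_value_def power)
  moreover have "(\<Prod>v\<in>A. Poly_Mapping.single (Poly_Mapping.single v (Poly_Mapping.lookup m v)) (1::'k)) =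
      Poly_Mapping.single (\<Sum>v\<in>A. Poly_Mapping.single v (Poly_Mapping.lookup m v)) 1" for A
    by (induction A rule: infinite_finite_induct) (simp_all add: mult_single)
  ultimately show ?thesis
    using poly_mapping_eq_sum_single[of m] by simp
qed

lemma line_subst_superset:
  assumes "finite A" "Poly_Mapping.keys p \<subseteq> A"
  shows "line_subst \<sigma> p =
    (\<Sum>m\<in>A. [:Poly_Mapping.single 0 (Poly_Mapping.lookup p m):] * monomial_value \<sigma> m)"
  unfolding line_subst_def
  by (rule sum.mono_neutral_left[OF assms]) (auto simp: in_keys_iff)

lemma line_subst_add: "line_subst \<sigma> (p + q) = line_subst \<sigma> p + line_subst \<sigma> q"
proof -
  let ?A = "Poly_Mapping.keys p \<union> Poly_Mapping.keys q"
  have "line_subst \<sigma> (p + q) =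
      (\<Sum>m\<in>?A. [:Poly_Mapping.single 0 (Poly_Mapping.lookup (p + q) m):] * monomial_value \<sigma> m)"
    by (intro line_subst_superset finite_UnI finite_keys Poly_Mapping.keys_add)
  also have "\<dots> =
      (\<Sum>m\<in>?A. [:Poly_Mapping.single 0 (Poly_Mapping.lookup p m):] * monomial_value \<sigma> m) +
      (\<Sum>m\<in>?A. [:Poly_Mapping.single 0 (Poly_Mapping.lookup q m):] * monomial_value \<sigma> m)"
    unfolding sum.distrib[symmetric] by (simp add: lookup_add single_add smult_add_left)
  also have "\<dots> = line_subst \<sigma> p + line_subst \<sigma> q"
    by (subst (1 2) line_subst_superset[of ?A]) auto
  finally show ?thesis .
qed

lemma line_subst_0 [simp]: "line_subst \<sigma> 0 = 0"
  by (simp add: line_subst_def)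

lemma line_subst_minus: "line_subst \<sigma> (- p) = - line_subst \<sigma> p"
  using line_subst_add[of \<sigma> p "- p"] by (simp add: eq_neg_iff_add_eq_0 add.commute)

lemma line_subst_diff: "line_subst \<sigma> (p - q) = line_subst \<sigma> p - line_subst \<sigma> q"
  using line_subst_add[of \<sigma> p "- q"] by (simp add: line_subst_minus)

lemma line_subst_sum: "line_subst \<sigma> (sum f A) = (\<Sum>x\<in>A. line_subst \<sigma> (f x))"
  by (induction A rule: infinite_finite_induct) (simp_all add: line_subst_add)

lemma line_subst_single:
  "line_subst \<sigma> (Poly_Mapping.single m c) = [:Poly_Mapping.single 0 c:] * monomial_value \<sigma> m"
  by (cases "c = 0") (simp_all add: line_subst_def)

lemma line_subst_mult: "line_subst \<sigma> (p * q) = line_subst \<sigma> p * line_subst \<sigma> q"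
proof -
  have monomials: "line_subst \<sigma> (Poly_Mapping.single m c * Poly_Mapping.single l d) =
      line_subst \<sigma> (Poly_Mapping.single m c) * line_subst \<sigma> (Poly_Mapping.single l d)" for m l c d
  proof -
    have "Poly_Mapping.single 0 (c * d) =
        Poly_Mapping.single 0 c * (Poly_Mapping.single 0 d :: ('a, 'b) mpoly)"
      by (simp add: mult_single)
    then show ?thesis
      by (simp add: mult_single line_subst_single monomial_value_add mult_ac)
  qed
  show ?thesis
    by (subst (1 2) poly_mapping_eq_sum_single)
      (simp add: sum_product line_subst_sum monomials, simp flip: sum_product line_subst_sum poly_mapping_eq_sum_single)
qed

lemma line_subst_mvar [simp]: "line_subst \<sigma> (mvar v) = \<sigma> v"
  by (simp add: mvar_def line_subst_single monomial_value_def)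


lemma line_subst_1 [simp]: "line_subst \<sigma> 1 = 1"
  using line_subst_single[of \<sigma> 0 1] by simp

text \<open>Setting \<open>t = 0\<close> in a translation gives back the polynomial.\<close>

lemma coeff_0_line_subst:
  assumes "\<And>v. coeff (\<sigma> v) 0 = mvar v"
  shows "coeff (line_subst \<sigma> p) 0 = p"
proof -
  have prod: "coeff (\<Prod>v\<in>A. g v) 0 = (\<Prod>v\<in>A. coeff (g v) 0)"
    for A and g :: "'a \<Rightarrow> ('a, 'b) mpoly poly"
    by (induction A rule: infinite_finite_induct) (simp_all add: coeff_mult)
  have power: "coeff (g ^ e) 0 = coeff g 0 ^ e" for e and g :: "('a, 'b) mpoly poly"
    by (induction e) (simp_all add: coeff_mult)
  have "coeff (monomial_value \<sigma> m) 0 = Poly_Mapping.single m 1" for m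
    by (simp add: monomial_value_def prod power assms flip: monomial_value_mvar)
  then show ?thesis
    by (simp add: line_subst_def coeff_sum mult_single flip: poly_mapping_eq_sum_single)
qed

section \<open>Ideals of multivariate polynomial rings\<close>

lemma mpoly_ring_simps [simp]:
  "monoid.mult (mpoly_ring V) = (*)" "one (mpoly_ring V) = 1"
  "ring.zero (mpoly_ring V) = 0" "add (mpoly_ring V) = (+)"
  by (simp_all add: mpoly_ring_def)

lemma mpoly_carrier_add:
  "p \<in> carrier (mpoly_ring V) \<Longrightarrow> q \<in> carrier (mpoly_ring V) \<Longrightarrow> p + q \<in> carrier (mpoly_ring V)"
  using cring.cring_simprules(1)[OF cring_mpoly_ring, of p V q] by simp

lemma mpoly_carrier_mult:
  "p \<in> carrier (mpoly_ring V) \<Longrightarrow> q \<in> carrier (mpoly_ring V) \<Longrightarrow> p * q \<in> carrier (mpoly_ring V)"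
  using cring.cring_simprules(5)[OF cring_mpoly_ring, of p V q] by simp

lemma mpoly_carrier_minus: "p \<in> carrier (mpoly_ring V) \<Longrightarrow> - p \<in> carrier (mpoly_ring V)"
  by (simp add: mpoly_ring_def)

lemma mpoly_carrier_diff:
  "p \<in> carrier (mpoly_ring V) \<Longrightarrow> q \<in> carrier (mpoly_ring V) \<Longrightarrow> p - q \<in> carrier (mpoly_ring V)"
  using mpoly_carrier_add[of p V "- q"] by (simp add: mpoly_carrier_minus)

lemma mpoly_carrier_const: "Poly_Mapping.single 0 c \<in> carrier (mpoly_ring V)"
  by (simp add: mpoly_ring_def)

lemma mpoly_carrier_0: "0 \<in> carrier (mpoly_ring V)"
  and mpoly_carrier_1: "1 \<in> carrier (mpoly_ring V)"
  by (simp_all add: mpoly_ring_def)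

lemma mpoly_carrier_mvar: "v \<in> V \<Longrightarrow> mvar v \<in> carrier (mpoly_ring V)"
  by (simp add: mpoly_ring_def mvar_def)

lemmas mpoly_carrier = mpoly_carrier_add mpoly_carrier_mult mpoly_carrier_minus mpoly_carrier_diff
  mpoly_carrier_const mpoly_carrier_0 mpoly_carrier_1 mpoly_carrier_mvar

lemma mpoly_carrier_sum:
  "(\<And>x. x \<in> A \<Longrightarrow> f x \<in> carrier (mpoly_ring V)) \<Longrightarrow> sum f A \<in> carrier (mpoly_ring V)"
  by (induction A rule: infinite_finite_induct) (simp_all add: mpoly_carrier)

lemma mpoly_idealI:
  fixes I :: "('v, 'k::comm_ring_1) mpoly set"
  assumes "I \<subseteq> carrier (mpoly_ring V)" "0 \<in> I"
    and add: "\<And>p q. p \<in> I \<Longrightarrow> q \<in> I \<Longrightarrow> p + q \<in> I"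
    and mult: "\<And>p q. p \<in> carrier (mpoly_ring V) \<Longrightarrow> q \<in> I \<Longrightarrow> p * q \<in> I"
  shows "ideal I (mpoly_ring V)"
proof (rule idealI)
  interpret cring "mpoly_ring V" by (rule cring_mpoly_ring)
  show "ring (mpoly_ring V)" by (rule ring_axioms)
  show "subgroup I (add_monoid (mpoly_ring V))"
  proof (rule add.subgroupI)
    fix p assume p: "p \<in> I"
    have "p \<oplus>\<^bsub>mpoly_ring V\<^esub> - p = \<zero>\<^bsub>mpoly_ring V\<^esub>" by simp
    then have "\<ominus>\<^bsub>mpoly_ring V\<^esub> p = - p"
      using p assms(1) by (intro sum_zero_eq_neg[symmetric]) (auto simp: mpoly_carrier add.commute)
    then show "\<ominus>\<^bsub>mpoly_ring V\<^esub> p \<in> I"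
      using mult[of "- 1" p] p by (simp add: mpoly_carrier)
  qed (use assms in auto)
next
  fix p q :: "('v, 'k) mpoly" assume "p \<in> I" "q \<in> carrier (mpoly_ring V)"
  then have "q * p \<in> I" by (intro mult)
  then show "q \<otimes>\<^bsub>mpoly_ring V\<^esub> p \<in> I" "p \<otimes>\<^bsub>mpoly_ring V\<^esub> q \<in> I"
    by (simp_all add: mult.commute)
qed

lemma mpoly_ideal_closed:
  assumes "ideal I (mpoly_ring V)"
  shows mpoly_ideal_0: "0 \<in> I"
    and mpoly_ideal_add: "\<And>p q. p \<in> I \<Longrightarrow> q \<in> I \<Longrightarrow> p + q \<in> I"
    and mpoly_ideal_mult: "\<And>p q. p \<in> carrier (mpoly_ring V) \<Longrightarrow> q \<in> I \<Longrightarrow> p * q \<in> I"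
    and mpoly_ideal_mult2: "\<And>p q. p \<in> carrier (mpoly_ring V) \<Longrightarrow> q \<in> I \<Longrightarrow> q * p \<in> I"
    and mpoly_ideal_diff: "\<And>p q. p \<in> I \<Longrightarrow> q \<in> I \<Longrightarrow> p - q \<in> I"
proof -
  interpret ideal I "mpoly_ring V" by fact
  show "0 \<in> I" "\<And>p q. p \<in> I \<Longrightarrow> q \<in> I \<Longrightarrow> p + q \<in> I"
    using additive_subgroup.zero_closed[OF is_additive_subgroup]
      additive_subgroup.a_closed[OF is_additive_subgroup] by simp_all
  show mult: "\<And>p q. p \<in> carrier (mpoly_ring V) \<Longrightarrow> q \<in> I \<Longrightarrow> p * q \<in> I"
    and "\<And>p q. p \<in> carrier (mpoly_ring V) \<Longrightarrow> q \<in> I \<Longrightarrow> q * p \<in> I"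
    using I_l_closed I_r_closed by simp_all
  show "p - q \<in> I" if "p \<in> I" "q \<in> I" for p q
    using additive_subgroup.a_closed[OF is_additive_subgroup, of p "- 1 * q"] mult[of "- 1" q] that by (simp add: mpoly_carrier)
qed

lemma mpoly_ideal_sum:
  assumes "ideal I (mpoly_ring V)" "\<And>x. x \<in> A \<Longrightarrow> f x \<in> I"
  shows "sum f A \<in> I"
  using assms(2)
  by (induction A rule: infinite_finite_induct)
    (simp_all add: mpoly_ideal_0[OF assms(1)] mpoly_ideal_add[OF assms(1)])

lemma coeff_line_subst_in_carrier:
  fixes p :: "('v, 'k::comm_ring_1) mpoly"
  assumes \<sigma>: "\<And>v k. v \<in> V \<Longrightarrow> coeff (\<sigma> v) k \<in> carrier (mpoly_ring V)"
    and p: "p \<in> carrier (mpoly_ring V)"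
  shows "coeff (line_subst \<sigma> p) k \<in> carrier (mpoly_ring V)"
proof -
  define T where "T = {q :: ('v, 'k) mpoly poly. \<forall>k. coeff q k \<in> carrier (mpoly_ring V)}"
  have const: "[:c:] \<in> T" if "c \<in> carrier (mpoly_ring V)" for c
    using that by (auto simp: T_def coeff_pCons mpoly_carrier split: nat.split)
  have mult: "q * r \<in> T" if "q \<in> T" "r \<in> T" for q r
    using that by (auto simp: T_def coeff_mult intro!: mpoly_carrier_sum mpoly_carrier)
  have one: "1 \<in> T"
    using const[of 1] by (simp add: mpoly_carrier one_pCons)
  have power: "q ^ e \<in> T" if "q \<in> T" for q e
    using that by (induction e) (simp_all add: one mult)
  have prod: "prod g A \<in> T" if "\<And>v. v \<in> A \<Longrightarrow> g v \<in> T" for A and g :: "'v \<Rightarrow> ('v, 'k) mpoly poly"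
    using that by (induction A rule: infinite_finite_induct) (simp_all add: one mult)
  have sum: "sum g A \<in> T" if "\<And>m. m \<in> A \<Longrightarrow> g m \<in> T"
    for A and g :: "('v \<Rightarrow>\<^sub>0 nat) \<Rightarrow> ('v, 'k) mpoly poly"
    using that by (auto simp: T_def coeff_sum intro!: mpoly_carrier_sum)
  have "Poly_Mapping.keys m \<subseteq> V" if "m \<in> Poly_Mapping.keys p" for m
    using p that by (simp add: mpoly_ring_def)
  then have "line_subst \<sigma> p \<in> T"
    unfolding line_subst_def monomial_value_def
    by (intro sum mult prod power const mpoly_carrier) (use \<sigma> in \<open>auto simp: T_def\<close>)
  then show ?thesis by (simp add: T_def)
qed

text \<open>A prime ideal \<open>P\<close> of \<open>S\<close> extends to a prime ideal \<open>P S[t]\<close> of \<open>S[t]\<close>: of two polynomials outside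
  \<open>P S[t]\<close>, the lowest coefficients outside \<open>P\<close> multiply to a coefficient of the product that is outside
  \<open>P\<close>, up to an element of \<open>P\<close>.\<close>

lemma primeideal_coeffwise:
  fixes p q :: "('v, 'k::comm_ring_1) mpoly poly"
  assumes P: "primeideal P (mpoly_ring V)"
    and p: "\<And>k. coeff p k \<in> carrier (mpoly_ring V)"
    and q: "\<And>k. coeff q k \<in> carrier (mpoly_ring V)"
    and pq: "\<And>k. coeff (p * q) k \<in> P"
  shows "(\<forall>k. coeff p k \<in> P) \<or> (\<forall>k. coeff q k \<in> P)"
proof (rule ccontr)
  assume "\<not> ?thesis"
  then have ex: "\<exists>k. coeff p k \<notin> P" "\<exists>k. coeff q k \<notin> P" by auto
  interpret primeideal P "mpoly_ring V" by fact
  note P_closed = mpoly_ideal_closed[OF is_ideal]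
  define i where "i = (LEAST k. coeff p k \<notin> P)"
  define j where "j = (LEAST k. coeff q k \<notin> P)"
  have i: "coeff p i \<notin> P" "\<And>k. k < i \<Longrightarrow> coeff p k \<in> P"
    unfolding i_def using LeastI_ex[OF ex(1)] not_less_Least by auto
  have j: "coeff q j \<notin> P" "\<And>k. k < j \<Longrightarrow> coeff q k \<in> P"
    unfolding j_def using LeastI_ex[OF ex(2)] not_less_Least by auto
  let ?rest = "\<Sum>k\<in>{..i + j} - {i}. coeff p k * coeff q (i + j - k)"
  have "?rest \<in> P"
  proof (rule mpoly_ideal_sum[OF is_ideal])
    fix k assume "k \<in> {..i + j} - {i}"
    then have "k < i \<or> i + j - k < j" by auto
    then show "coeff p k * coeff q (i + j - k) \<in> P"
      using i(2) j(2) p q P_closed(3,4) by blast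
  qed
  moreover have "coeff (p * q) (i + j) = coeff p i * coeff q j + ?rest"
    by (simp add: coeff_mult sum.remove[of "{..i + j}" i])
  ultimately have "coeff p i * coeff q j \<in> P"
    using P_closed(5)[OF pq[of "i + j"]] by fastforce
  then show False
    using I_prime[of "coeff p i" "coeff q j"] p q i(1) j(1) by simp
qed

lemma primeideal_line_subst_vimage:
  assumes P: "primeideal P (mpoly_ring V)"
    and \<sigma>: "\<And>v k. v \<in> V \<Longrightarrow> coeff (\<sigma> v) k \<in> carrier (mpoly_ring V)"
  shows "primeideal {f \<in> carrier (mpoly_ring V). \<forall>k. coeff (line_subst \<sigma> f) k \<in> P} (mpoly_ring V)"
    (is "primeideal ?P' _")
proof (rule primeidealI)
  interpret primeideal P "mpoly_ring V" by fact
  note P_closed = mpoly_ideal_closed[OF is_ideal]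
  note carrier = coeff_line_subst_in_carrier[OF \<sigma>]
  show "cring (mpoly_ring V)" by (rule cring_mpoly_ring)
  show "ideal ?P' (mpoly_ring V)"
    by (rule mpoly_idealI)
      (auto simp: mpoly_carrier line_subst_add line_subst_mult coeff_mult P_closed carrier
        intro!: mpoly_ideal_sum[OF is_ideal])
  have "1 \<notin> P"
    using I_notcarr one_imp_carrier by auto
  then have "1 \<notin> ?P'"
    by (auto intro!: exI[of _ 0])
  then show "carrier (mpoly_ring V) \<noteq> ?P'"
    using mpoly_carrier_1 by blast
  fix f g
  assume f: "f \<in> carrier (mpoly_ring V)" and g: "g \<in> carrier (mpoly_ring V)"
    and fg: "f \<otimes>\<^bsub>mpoly_ring V\<^esub> g \<in> ?P'"
  have "(\<forall>k. coeff (line_subst \<sigma> f) k \<in> P) \<or> (\<forall>k. coeff (line_subst \<sigma> g) k \<in> P)"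
    by (rule primeideal_coeffwise[OF P carrier[OF _ f] carrier[OF _ g]])
      (use fg in \<open>simp_all add: line_subst_mult\<close>)
  then show "f \<in> ?P' \<or> g \<in> ?P'"
    using f g by blast
qed

section \<open>Localisation and symbolic powers\<close>

text \<open>For a prime ideal \<open>P\<close>, the contraction of \<open>J R\<^sub>P\<close> to \<open>R\<close>, without forming the localisation.\<close>

definition saturation :: "('a, 'b) ring_scheme \<Rightarrow> 'a set \<Rightarrow> 'a set \<Rightarrow> 'a set" where
  "saturation R P J = {f \<in> carrier R. \<exists>s\<in>carrier R - P. s \<otimes>\<^bsub>R\<^esub> f \<in> J}"

lemma saturation_mult_right:
  assumes "cring R" "ideal J R" "f \<in> saturation R P J" "g \<in> carrier R"
  shows "f \<otimes>\<^bsub>R\<^esub> g \<in> saturation R P J"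
proof -
  interpret cring R by fact
  from assms(3) obtain s where "f \<in> carrier R" "s \<in> carrier R - P" "s \<otimes>\<^bsub>R\<^esub> f \<in> J"
    by (auto simp: saturation_def)
  then show ?thesis
    using ideal.I_r_closed[OF assms(2), of "s \<otimes>\<^bsub>R\<^esub> f" g] assms(4)
    by (auto simp: saturation_def m_assoc)
qed

lemma saturation_ideal_prod:
  assumes "primeideal P R" "f \<in> saturation R P I" "g \<in> saturation R P J"
  shows "f \<otimes>\<^bsub>R\<^esub> g \<in> saturation R P (I \<cdot>\<^bsub>R\<^esub> J)"
proof -
  interpret primeideal P R by fact
  from assms(2) obtain s where s: "f \<in> carrier R" "s \<in> carrier R - P" "s \<otimes>\<^bsub>R\<^esub> f \<in> I"
    by (auto simp: saturation_def)
  from assms(3) obtain t where t: "g \<in> carrier R" "t \<in> carrier R - P" "t \<otimes>\<^bsub>R\<^esub> g \<in> J"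
    by (auto simp: saturation_def)
  have "(s \<otimes>\<^bsub>R\<^esub> t) \<otimes>\<^bsub>R\<^esub> (f \<otimes>\<^bsub>R\<^esub> g) = (s \<otimes>\<^bsub>R\<^esub> f) \<otimes>\<^bsub>R\<^esub> (t \<otimes>\<^bsub>R\<^esub> g)"
    using s t by (simp add: m_ac)
  then have "(s \<otimes>\<^bsub>R\<^esub> t) \<otimes>\<^bsub>R\<^esub> (f \<otimes>\<^bsub>R\<^esub> g) \<in> I \<cdot>\<^bsub>R\<^esub> J"
    using s t by (simp add: ideal_prod.prod)
  moreover have "s \<otimes>\<^bsub>R\<^esub> t \<in> carrier R - P"
    using s t I_prime by auto
  ultimately show ?thesis
    using s t by (auto simp: saturation_def)
qed

text \<open>Membership may be checked locally at the minimal primes: if \<open>s f\<close> is in the power and thus in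
  the \<open>P\<close>-primary component \<open>Q\<close>, where \<open>s\<close> is outside \<open>P\<close>, the radical of \<open>Q\<close>, then \<open>f\<close> is in \<open>Q\<close>.\<close>

lemma symbolic_powerI:
  assumes f: "f \<in> carrier R"
    and local: "\<And>P. P \<in> minimal_primes R I \<Longrightarrow> f \<in> saturation R P (ideal_power R I m)"
  shows "f \<in> symbolic_power R I m"
  unfolding symbolic_power_def
proof (intro IntI InterI f)
  fix Q
  assume "Q \<in> {Q. \<exists>P\<in>minimal_primes R I. is_primary_component R (ideal_power R I m) P Q}"
  then obtain P \<Q> where P: "P \<in> minimal_primes R I"
    and \<Q>: "minimal_primary_decomposition R (ideal_power R I m) \<Q>" "Q \<in> \<Q>" "ideal_radical R Q = P"
    by (auto simp: is_primary_component_def)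
  obtain s where s: "s \<in> carrier R" "s \<notin> P" "s \<otimes>\<^bsub>R\<^esub> f \<in> ideal_power R I m"
    using local[OF P] by (auto simp: saturation_def)
  interpret primeideal P R
    using P by (simp add: minimal_primes_def)
  have "f \<otimes>\<^bsub>R\<^esub> s \<in> Q"
    using s f \<Q> by (auto simp: minimal_primary_decomposition_def m_comm)
  then show "f \<in> Q"
    using s f \<Q> by (auto simp: minimal_primary_decomposition_def primary_ideal_def)
qed

lemma ideal_power_2:
  assumes "cring R" "ideal I R"
  shows "ideal_power R I 2 = I \<cdot>\<^bsub>R\<^esub> I"
proof -
  interpret cring R by fact
  have "ideal_power R I 2 = (carrier R \<cdot>\<^bsub>R\<^esub> I) \<cdot>\<^bsub>R\<^esub> I"
    by (simp add: numeral_2_eq_2 nat_pow_def ideals_set_def)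
  also have "carrier R \<cdot>\<^bsub>R\<^esub> I = I"
    using ideal_prod_commute[OF oneideal assms(2)] ideal_prod_one[OF assms(2)] by simp
  finally show ?thesis .
qed


section \<open>Edge binomials and minors\<close>

definition edge_binomial :: "nat \<Rightarrow> nat \<Rightarrow> (xyvar, 'k::field) mpoly" where
  "edge_binomial i j = mvar (X i) * mvar (X j) - mvar (Y i) * mvar (Y j)"

definition xy_minor :: "nat \<Rightarrow> nat \<Rightarrow> (xyvar, 'k::field) mpoly" where
  "xy_minor i j = mvar (X i) * mvar (Y j) - mvar (Y i) * mvar (X j)"

lemma cring_xy_ring: "cring (xy_ring n)"
  by (simp add: xy_ring_def cring_mpoly_ring)

lemma xy_ring_simps [simp]:
  "monoid.mult (xy_ring n) = (*)" "one (xy_ring n) = 1"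
  "ring.zero (xy_ring n) = 0" "add (xy_ring n) = (+)"
  by (simp_all add: xy_ring_def)

lemma xy_ring_carrier_vars:
  "i \<in> {1..n} \<Longrightarrow> mvar (X i) \<in> carrier (xy_ring n)"
  "i \<in> {1..n} \<Longrightarrow> mvar (Y i) \<in> carrier (xy_ring n)"
  by (auto simp: xy_ring_def intro!: mpoly_carrier_mvar)

lemma xy_ring_carrier_ops:
  fixes p q :: "(xyvar, 'k::field) mpoly"
  shows "p \<in> carrier (xy_ring n) \<Longrightarrow> q \<in> carrier (xy_ring n) \<Longrightarrow> p * q \<in> carrier (xy_ring n)"
    and "p \<in> carrier (xy_ring n) \<Longrightarrow> q \<in> carrier (xy_ring n) \<Longrightarrow> p - q \<in> carrier (xy_ring n)"
    and "0 \<in> carrier (xy_ring n :: (xyvar, 'k) mpoly ring)"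
    and "1 \<in> carrier (xy_ring n :: (xyvar, 'k) mpoly ring)"
  by (simp_all add: xy_ring_def mpoly_carrier)

lemmas xy_ring_carrier = xy_ring_carrier_vars xy_ring_carrier_ops

lemma xy_minor_carrier:
  "i \<in> {1..n} \<Longrightarrow> j \<in> {1..n} \<Longrightarrow> xy_minor i j \<in> carrier (xy_ring n)"
  by (simp add: xy_minor_def xy_ring_carrier)

lemma edge_endpoints:
  assumes "simple_graph {1..n} E" "{i, j} \<in> E"
  shows "i \<in> {1..n}" "j \<in> {1..n}" "i \<noteq> j"
  using assms by (fastforce simp: simple_graph_def)+

lemma parity_ideal_generators:
  assumes "simple_graph {1..n} E"
  shows "{mvar (X i) * mvar (X j) - mvar (Y i) * mvar (Y j) | i j. {i, j} \<in> E}
    \<subseteq> carrier (xy_ring n :: (xyvar, 'k::field) mpoly ring)"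
  using edge_endpoints[OF assms] by (auto intro!: xy_ring_carrier)

lemma ideal_parity_ideal:
  assumes "simple_graph {1..n} E"
  shows "ideal (parity_binomial_edge_ideal n E) (xy_ring n)"
  unfolding parity_binomial_edge_ideal_def
  by (intro ring.genideal_ideal cring.axioms(1) cring_xy_ring parity_ideal_generators assms)

lemma edge_binomial_in_parity_ideal:
  assumes "{i, j} \<in> E"
  shows "edge_binomial i j \<in> parity_binomial_edge_ideal n E"
  using assms unfolding parity_binomial_edge_ideal_def genideal_def edge_binomial_def by blast

lemma parity_ideal_subset:
  assumes "ideal J (xy_ring n)" "\<And>i j. {i, j} \<in> E \<Longrightarrow> edge_binomial i j \<in> J"
  shows "parity_binomial_edge_ideal n E \<subseteq> J"
  unfolding parity_binomial_edge_ideal_def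
  by (rule ring.genideal_minimal)
    (use assms cring.axioms(1)[OF cring_xy_ring] in \<open>auto simp: edge_binomial_def\<close>)

text \<open>The edges \<open>{k, i}\<close> and \<open>{k, j}\<close> make the columns \<open>(x\<^sub>i, y\<^sub>i)\<close> and \<open>(x\<^sub>j, y\<^sub>j)\<close> both orthogonal to
  \<open>(x\<^sub>k, - y\<^sub>k)\<close>; hence they are proportional wherever \<open>(x\<^sub>k, y\<^sub>k)\<close> does not vanish.\<close>

lemma minor_of_neighbours:
  assumes "simple_graph {1..n} E" "{k, i} \<in> E" "{k, j} \<in> E"
  shows "mvar (X k) * xy_minor i j \<in> (parity_binomial_edge_ideal n E :: (xyvar, 'k::field) mpoly set)"
    and "mvar (Y k) * xy_minor i j \<in> (parity_binomial_edge_ideal n E :: (xyvar, 'k) mpoly set)"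
proof -
  note I = mpoly_ideal_closed[OF ideal_parity_ideal[OF assms(1), unfolded xy_ring_def], folded xy_ring_def]
  note vertices = edge_endpoints[OF assms(1,2)] edge_endpoints[OF assms(1,3)]
  have "(mvar (X k) * xy_minor i j :: (xyvar, 'k) mpoly) =
      mvar (Y j) * edge_binomial k i - mvar (Y i) * edge_binomial k j"
    and "(mvar (Y k) * xy_minor i j :: (xyvar, 'k) mpoly) =
      mvar (X j) * edge_binomial k i - mvar (X i) * edge_binomial k j"
    by (simp_all add: xy_minor_def edge_binomial_def algebra_simps)
  then show "mvar (X k) * xy_minor i j \<in> (parity_binomial_edge_ideal n E :: (xyvar, 'k) mpoly set)"
    and "mvar (Y k) * xy_minor i j \<in> (parity_binomial_edge_ideal n E :: (xyvar, 'k) mpoly set)"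
    using assms(2,3) vertices
    by (simp_all add: I xy_ring_carrier edge_binomial_in_parity_ideal)
qed

section \<open>The vertices whose variables vanish at a minimal prime\<close>

text \<open>The assumption on the neighbours says that moving the column of \<open>k\<close> in direction \<open>(\<alpha>, \<beta>)\<close> keeps
  every edge binomial zero modulo \<open>P\<close>. The polynomials that vanish modulo \<open>P\<close> along this motion form a
  prime ideal between \<open>I\<close> and \<open>P\<close>, which by minimality is \<open>P\<close> itself. As it contains \<open>x\<^sub>k\<close> and
  \<open>y\<^sub>k\<close>, their velocities \<open>\<alpha>\<close> and \<open>\<beta>\<close> vanish modulo \<open>P\<close>.\<close>

lemma minimal_prime_no_translation:
  fixes P :: "(xyvar, 'k::field) mpoly set"
  assumes graph: "simple_graph {1..n} E"
    and P: "P \<in> minimal_primes (xy_ring n) (parity_binomial_edge_ideal n E)"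
    and k: "k \<in> {1..n}" "mvar (X k) \<in> P" "mvar (Y k) \<in> P"
    and \<alpha>: "\<alpha> \<in> carrier (xy_ring n)" and \<beta>: "\<beta> \<in> carrier (xy_ring n)"
    and neighbours: "\<And>j. {k, j} \<in> E \<Longrightarrow> \<alpha> * mvar (X j) - \<beta> * mvar (Y j) \<in> P"
  shows "\<alpha> \<in> P \<and> \<beta> \<in> P"
proof -
  define \<sigma> :: "xyvar \<Rightarrow> (xyvar, 'k) mpoly poly" where
    "\<sigma> v = [:mvar v, if v = X k then \<alpha> else if v = Y k then \<beta> else 0:]" for v
  define P' where "P' = {f \<in> carrier (xy_ring n). \<forall>m. coeff (line_subst \<sigma> f) m \<in> P}"
  interpret primeideal P "xy_ring n"
    using P by (simp add: minimal_primes_def)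
  note P_closed = mpoly_ideal_closed[OF is_ideal[unfolded xy_ring_def], folded xy_ring_def]
  have edge_P: "edge_binomial i j \<in> P" if "{i, j} \<in> E" for i j
    using P edge_binomial_in_parity_ideal[OF that] by (auto simp: minimal_primes_def)
  have prime': "primeideal P' (xy_ring n)"
    unfolding P'_def xy_ring_def
    by (rule primeideal_line_subst_vimage)
      (use primeideal_axioms \<alpha> \<beta> in \<open>auto simp: \<sigma>_def xy_ring_def coeff_pCons intro!: mpoly_carrier split: nat.split\<close>)
  interpret P': primeideal P' "xy_ring n" by (rule prime')
  have "edge_binomial i j \<in> P'" if ij: "{i, j} \<in> E" for i j
  proof -
    note vertices = edge_endpoints[OF graph ij]
    have image: "line_subst \<sigma> (edge_binomial i j) =
      [:edge_binomial i j,
        (if i = k then \<alpha> * mvar (X j) - \<beta> * mvar (Y j)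
         else if j = k then \<alpha> * mvar (X i) - \<beta> * mvar (Y i) else 0):]"
      using vertices
      by (simp add: edge_binomial_def line_subst_diff line_subst_mult \<sigma>_def algebra_simps)
    have "(edge_binomial i j :: (xyvar, 'k) mpoly) \<in> carrier (xy_ring n)"
      using Icarr[OF edge_P[OF ij]] .
    moreover have "coeff (line_subst \<sigma> (edge_binomial i j)) m \<in> P" for m
      using ij neighbours[of j] neighbours[of i] edge_P[OF ij]
      by (auto simp: image coeff_pCons P_closed insert_commute split: nat.split)
    ultimately show ?thesis
      unfolding P'_def by blast
  qed
  then have "parity_binomial_edge_ideal n E \<subseteq> P'"
    by (rule parity_ideal_subset[OF P'.is_ideal])
  moreover have "P' \<subseteq> P"
  proof
    fix f assume "f \<in> P'"
    then have "coeff (line_subst \<sigma> f) 0 \<in> P"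
      unfolding P'_def by blast
    moreover have "coeff (line_subst \<sigma> f) 0 = f"
      by (rule coeff_0_line_subst) (simp add: \<sigma>_def)
    ultimately show "f \<in> P" by (simp only:)
  qed
  ultimately have eq: "P' = P"
    using P prime' unfolding minimal_primes_def by blast
  have "mvar (X k) \<in> P'" "mvar (Y k) \<in> P'"
    using k(2,3) unfolding eq by blast+
  then have "coeff (line_subst \<sigma> (mvar (X k))) 1 \<in> P" "coeff (line_subst \<sigma> (mvar (Y k))) 1 \<in> P"
    unfolding P'_def by blast+
  then show ?thesis
    by (simp add: \<sigma>_def)
qed

text \<open>Some minor of two neighbours \<open>i, j\<close> of \<open>k\<close> is outside \<open>P\<close>, for otherwise the column of \<open>k\<close> could be
  moved as in \<open>minimal_prime_no_translation\<close>. This minor carries \<open>x\<^sub>k\<close> and \<open>y\<^sub>k\<close>, and therefore every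
  minor of the column of \<open>k\<close>, into the ideal.\<close>

lemma minor_at_vanishing_vertex_in_saturation:
  fixes P :: "(xyvar, 'k::field) mpoly set"
  assumes graph: "simple_graph {1..n} E"
    and P: "P \<in> minimal_primes (xy_ring n) (parity_binomial_edge_ideal n E)"
    and k: "k \<in> {1..n}" "mvar (X k) \<in> P" "mvar (Y k) \<in> P"
    and l: "l \<in> {1..n}"
  shows "xy_minor k l \<in> saturation (xy_ring n) P (parity_binomial_edge_ideal n E)"
proof -
  interpret primeideal P "xy_ring n"
    using P by (simp add: minimal_primes_def)
  note P_closed = mpoly_ideal_closed[OF is_ideal[unfolded xy_ring_def], folded xy_ring_def]
  have "\<exists>i j. {k, i} \<in> E \<and> {k, j} \<in> E \<and> (xy_minor i j :: (xyvar, 'k) mpoly) \<notin> P"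
  proof (rule ccontr)
    assume "\<not> ?thesis"
    then have minors: "(xy_minor i j :: (xyvar, 'k) mpoly) \<in> P"
      if "{k, i} \<in> E" "{k, j} \<in> E" for i j
      using that by blast
    have "\<exists>\<alpha>\<in>carrier (xy_ring n). \<exists>\<beta>\<in>carrier (xy_ring n). (\<alpha> \<notin> P \<or> \<beta> \<notin> P) \<and>
        (\<forall>j. {k, j} \<in> E \<longrightarrow> \<alpha> * mvar (X j) - \<beta> * mvar (Y j) \<in> P)"
      \<comment> \<open>If the columns of all neighbours are multiples of a non-zero column \<open>(x\<^sub>i, y\<^sub>i)\<close>, then
        \<open>(y\<^sub>i, x\<^sub>i)\<close> is a possible direction; if they are all zero, then any direction is.\<close>
    proof (cases "\<exists>i. {k, i} \<in> E \<and> (mvar (X i) \<notin> P \<or> mvar (Y i) \<notin> P)")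
      case True
      then obtain i where i: "{k, i} \<in> E" "mvar (X i) \<notin> P \<or> mvar (Y i) \<notin> P" by blast
      show ?thesis
        using i minors[OF _ i(1)] edge_endpoints[OF graph i(1)]
        by (intro bexI[of _ "mvar (Y i)"] bexI[of _ "mvar (X i)"])
          (auto simp: xy_minor_def mult.commute xy_ring_carrier)
    next
      case False
      have "(1 :: (xyvar, 'k) mpoly) \<notin> P"
        using I_notcarr one_imp_carrier by auto
      then show ?thesis
        using False by (intro bexI[of _ 1] bexI[of _ 0]) (auto simp: xy_ring_carrier)
    qed
    then show False
      using minimal_prime_no_translation[OF graph P k] by blast
  qed
  then obtain i j where ij: "{k, i} \<in> E" "{k, j} \<in> E" "(xy_minor i j :: (xyvar, 'k) mpoly) \<notin> P"
    by blast
  let ?I = "parity_binomial_edge_ideal n E :: (xyvar, 'k) mpoly set"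
  note I = mpoly_ideal_closed[OF ideal_parity_ideal[OF graph, unfolded xy_ring_def], folded xy_ring_def]
  have "mvar (Y l) * (mvar (X k) * xy_minor i j) - mvar (X l) * (mvar (Y k) * xy_minor i j) \<in> ?I"
    by (intro I(5) I(3)[OF _ minor_of_neighbours(1)[OF graph ij(1,2)]]
        I(3)[OF _ minor_of_neighbours(2)[OF graph ij(1,2)]] xy_ring_carrier_vars l)
  then have "xy_minor i j * xy_minor k l \<in> ?I"
    by (simp add: xy_minor_def[of k l] algebra_simps)
  moreover have "xy_minor i j \<in> carrier (xy_ring n) - P" "xy_minor k l \<in> carrier (xy_ring n)"
    using edge_endpoints[OF graph ij(1)] edge_endpoints[OF graph ij(2)] ij(3) l
    by (simp_all add: xy_minor_carrier)
  ultimately show ?thesis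
    by (auto simp: saturation_def)
qed

section \<open>A triangle with pendant edges\<close>

lemma minor_product_in_symbolic_square:
  assumes graph: "simple_graph {1..n} E"
    and triangle: "{a, b} \<in> E" "{b, c} \<in> E" "{c, a} \<in> E"
    and pendant: "{a, a'} \<in> E" "{b, b'} \<in> E" "{c, c'} \<in> E"
  shows "xy_minor a b' * xy_minor b c' * xy_minor c a' \<in>
    symbolic_power (xy_ring n) (parity_binomial_edge_ideal n E :: (xyvar, 'k::field) mpoly set) 2"
proof (rule symbolic_powerI)
  let ?R = "xy_ring n :: (xyvar, 'k) mpoly ring"
  let ?I = "parity_binomial_edge_ideal n E :: (xyvar, 'k) mpoly set"
  note I = ideal_parity_ideal[OF graph]
  have vertices: "a \<in> {1..n}" "b \<in> {1..n}" "c \<in> {1..n}" "a' \<in> {1..n}" "b' \<in> {1..n}" "c' \<in> {1..n}"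
    using edge_endpoints(1,2)[OF graph pendant(1)] edge_endpoints(1,2)[OF graph pendant(2)]
      edge_endpoints(1,2)[OF graph pendant(3)] by blast+
  note carrier = xy_minor_carrier[OF vertices(1,5)] xy_minor_carrier[OF vertices(2,6)]
    xy_minor_carrier[OF vertices(3,4)]
  then show "xy_minor a b' * xy_minor b c' * xy_minor c a' \<in> carrier ?R"
    by (intro xy_ring_carrier)
  fix P assume P: "P \<in> minimal_primes ?R ?I"
  let ?S = "saturation ?R P"
  interpret primeideal P ?R
    using P by (simp add: minimal_primes_def)
  \<comment> \<open>A triangle vertex \<open>k\<close> is an index of one factor and a common neighbour of the indices of another.\<close>
  have factors: "xy_minor k j \<in> ?S ?I \<or> xy_minor i k' \<in> ?S ?I"
    if ik: "{k, i} \<in> E" and kk': "{k, k'} \<in> E" and j: "j \<in> {1..n}" for k i k' j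
  proof (cases "mvar (X k) \<in> P \<and> mvar (Y k) \<in> P")
    case True
    then show ?thesis
      using minor_at_vanishing_vertex_in_saturation[OF graph P _ _ _ j] edge_endpoints[OF graph ik] by blast
  next
    case False
    have "xy_minor i k' \<in> carrier ?R" "mvar (X k) \<in> carrier ?R" "mvar (Y k) \<in> carrier ?R"
      using edge_endpoints[OF graph ik] edge_endpoints[OF graph kk']
      by (simp_all add: xy_minor_carrier xy_ring_carrier)
    then have "xy_minor i k' \<in> ?S ?I"
      using False minor_of_neighbours[OF graph ik kk'] by (auto simp: saturation_def)
    then show ?thesis ..
  qed
  have square: "ideal (?I \<cdot>\<^bsub>?R\<^esub> ?I) ?R"
    using ring.ideal_prod_is_ideal[OF cring.axioms(1)[OF cring_xy_ring] I I] .
  have two_factors: "p * q * r \<in> ?S (ideal_power ?R ?I 2)"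
    if "p \<in> ?S ?I" "q \<in> ?S ?I" "r \<in> carrier ?R" for p q r
    using saturation_mult_right[OF cring_xy_ring square saturation_ideal_prod[OF primeideal_axioms that(1,2)] that(3)]
    by (simp add: ideal_power_2[OF cring_xy_ring I])
  have "xy_minor a b' \<in> ?S ?I \<or> xy_minor c a' \<in> ?S ?I"
    "xy_minor b c' \<in> ?S ?I \<or> xy_minor a b' \<in> ?S ?I"
    "xy_minor c a' \<in> ?S ?I \<or> xy_minor b c' \<in> ?S ?I"
    using factors[of a c a' b'] factors[of b a b' c'] factors[of c b c' a'] triangle pendant vertices
    by (simp_all add: insert_commute)
  then consider "xy_minor a b' \<in> ?S ?I" "xy_minor b c' \<in> ?S ?I"
    | "xy_minor b c' \<in> ?S ?I" "xy_minor c a' \<in> ?S ?I"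
    | "xy_minor c a' \<in> ?S ?I" "xy_minor a b' \<in> ?S ?I"
    by blast
  then show "xy_minor a b' * xy_minor b c' * xy_minor c a' \<in> ?S (ideal_power ?R ?I 2)"
  proof cases
    case 1
    then show ?thesis using two_factors carrier by blast
  next
    case 2
    then show ?thesis using two_factors[OF 2 carrier(1)] by (simp add: mult_ac)
  next
    case 3
    then show ?thesis using two_factors[OF 3 carrier(2)] by (simp add: mult_ac)
  qed
qed

text \<open>The order of vanishing in \<open>t\<close> along a suitable line is at least \<open>2\<close> on the ideal, so at least
  \<open>4\<close> on its square, but it is \<open>3\<close> on the product of minors.\<close>

lemma minor_product_not_in_square:
  assumes graph: "simple_graph {1..n} E"
    and disjoint: "{a, b, c} \<inter> {a', b', c'} = {}"
    and independent: "\<And>i j. {i, j} \<in> E \<Longrightarrow> \<not> {i, j} \<subseteq> {a', b', c'}"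
  shows "xy_minor a b' * xy_minor b c' * xy_minor c a' \<notin>
    ideal_power (xy_ring n) (parity_binomial_edge_ideal n E :: (xyvar, 'k::field) mpoly set) 2"
proof -
  let ?R = "xy_ring n :: (xyvar, 'k) mpoly ring"
  let ?I = "parity_binomial_edge_ideal n E :: (xyvar, 'k) mpoly set"
  let ?t = "monom 1 1 :: (xyvar, 'k) mpoly poly"
  define \<sigma> where
    "\<sigma> v = (case v of X i \<Rightarrow> if i \<in> {a', b', c'} then 1 else 0 | Y i \<Rightarrow> if i \<in> {a, b, c} then ?t else 0)" for v
  define J where "J d = {f \<in> carrier ?R. monom 1 d dvd line_subst \<sigma> f}" for d
  have J: "ideal (J d) ?R" for d
    unfolding J_def xy_ring_def
    by (rule mpoly_idealI) (auto simp: line_subst_add line_subst_mult mpoly_carrier)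
  have "edge_binomial i j \<in> J 2" if ij: "{i, j} \<in> E" for i j
  proof -
    have "\<sigma> (X i) * \<sigma> (X j) = 0"
      using independent[OF ij] by (auto simp: \<sigma>_def)
    then have "line_subst \<sigma> (edge_binomial i j) = - (\<sigma> (Y i) * \<sigma> (Y j))"
      by (simp add: edge_binomial_def line_subst_diff line_subst_mult)
    moreover have "monom 1 2 dvd \<sigma> (Y i) * \<sigma> (Y j)"
      by (simp add: \<sigma>_def mult_monom numeral_2_eq_2)
    ultimately show ?thesis
      using edge_endpoints[OF graph ij] by (simp add: J_def edge_binomial_def xy_ring_carrier)
  qed
  then have I_J: "?I \<subseteq> J 2"
    by (rule parity_ideal_subset[OF J])
  have "f \<in> J 4" if "f \<in> ?I \<cdot>\<^bsub>?R\<^esub> ?I" for f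
    using that
  proof induction
    case (prod p q)
    then have "p \<in> J 2" "q \<in> J 2" using I_J by auto
    moreover have "monom 1 4 = (monom 1 2 * monom 1 2 :: (xyvar, 'k) mpoly poly)"
      by (simp add: mult_monom)
    ultimately show ?case
      by (auto simp: J_def line_subst_mult xy_ring_carrier intro: mult_dvd_mono)
  next
    case (sum p q)
    then show ?case
      using additive_subgroup.a_closed[OF ideal.axioms(1)[OF J]] by auto
  qed
  moreover have "xy_minor a b' * xy_minor b c' * xy_minor c a' \<notin> J 4"
  proof -
    have minor: "line_subst \<sigma> (xy_minor i j) = - ?t" if "i \<in> {a, b, c}" "j \<in> {a', b', c'}" for i j
    proof -
      have "\<sigma> (X i) = 0" "\<sigma> (Y i) = ?t" "\<sigma> (X j) = 1"
        using that disjoint by (auto simp: \<sigma>_def)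
      then show ?thesis
        by (simp add: xy_minor_def line_subst_diff line_subst_mult)
    qed
    have "line_subst \<sigma> (xy_minor a b' * xy_minor b c' * xy_minor c a') = - monom 1 3"
      by (simp add: line_subst_mult minor mult_monom numeral_3_eq_3)
    then show ?thesis
      by (simp add: J_def monom_1_dvd_iff' coeff_monom)
  qed
  ultimately show ?thesis
    using ideal_power_2[OF cring_xy_ring ideal_parity_ideal[OF graph]] by auto
qed

text \<open>An induced net supplies more than the six edges: as it is induced, no edge joins two of its
  leaves.\<close>

lemma net_configuration:
  assumes "\<not> net_free V E"
  obtains a b c a' b' c' where
    "{a, b} \<in> E" "{b, c} \<in> E" "{c, a} \<in> E" "{a, a'} \<in> E" "{b, b'} \<in> E" "{c, c'} \<in> E"
    "{a, b, c} \<inter> {a', b', c'} = {}" "\<And>e. e \<in> E \<Longrightarrow> \<not> e \<subseteq> {a', b', c'}"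
proof -
  from assms obtain W f where f: "bij_betw f net_vertices W"
    and edges: "induced_edges E W = (`) f ` net_edges"
    by (auto simp: net_free_def is_net_def graph_isomorphic_def)
  have inj: "f i = f j \<longleftrightarrow> i = j" if "i \<in> {1..6}" "j \<in> {1..6}" for i j
    using f that by (auto simp: bij_betw_def net_vertices_def dest: inj_onD)
  have edge: "f ` e \<in> E" if "e \<in> net_edges" for e
  proof -
    have "f ` e \<in> induced_edges E W" using edges that by simp
    then show ?thesis by (simp add: induced_edges_def)
  qed
  show thesis
  proof (rule that[of "f 2" "f 3" "f 5" "f 1" "f 4" "f 6"])
    show "{f 2, f 3} \<in> E" "{f 3, f 5} \<in> E" "{f 5, f 2} \<in> E"
      "{f 2, f 1} \<in> E" "{f 3, f 4} \<in> E" "{f 5, f 6} \<in> E"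
      using edge[of "{2,3}"] edge[of "{3,5}"] edge[of "{2,5}"] edge[of "{1,2}"] edge[of "{3,4}"]
        edge[of "{5,6}"] by (simp_all add: net_edges_def insert_commute)
    show "{f 2, f 3, f 5} \<inter> {f 1, f 4, f 6} = {}"
      by (simp add: inj)
    fix e assume e: "e \<in> E"
    show "\<not> e \<subseteq> {f 1, f 4, f 6}"
    proof
      assume sub: "e \<subseteq> {f 1, f 4, f 6}"
      have "{f 1, f 4, f 6} \<subseteq> W"
        using f by (auto simp: bij_betw_def net_vertices_def)
      with e sub have "e \<in> induced_edges E W"
        by (auto simp: induced_edges_def)
      then obtain d where "d \<in> net_edges" "e = f ` d"
        using edges by auto
      then show False
        using sub by (auto simp: net_edges_def inj)
    qed
  qed
qed

theorem theorem2p4: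
  fixes n :: nat and E :: "nat set set"
  assumes graph: "simple_graph {1..n} E"
    and char: "CHAR('k::field) \<noteq> 2"
    and powers: "\<forall>t::nat. t \<ge> 1 \<longrightarrow>
      symbolic_power (xy_ring n) (parity_binomial_edge_ideal n E :: (xyvar, 'k) mpoly set) t =
      ideal_power (xy_ring n) (parity_binomial_edge_ideal n E) t"
  shows "net_free {1..n} E"
proof (rule ccontr)
  assume "\<not> ?thesis"
  then obtain a b c a' b' c' where net:
    "{a, b} \<in> E" "{b, c} \<in> E" "{c, a} \<in> E" "{a, a'} \<in> E" "{b, b'} \<in> E" "{c, c'} \<in> E"
    "{a, b, c} \<inter> {a', b', c'} = {}" "\<And>e. e \<in> E \<Longrightarrow> \<not> e \<subseteq> {a', b', c'}"
    by (rule net_configuration) (rule that)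
  show False
    using minor_product_in_symbolic_square[OF graph net(1-6), where 'k = 'k]
      minor_product_not_in_square[OF graph net(7,8), where 'k = 'k] powers by simp
qed

end
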